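(* Let $v=p^s$ for a prime $p$, let $\{D_1,\dots,D_m\}$ be a nontrivial $(v,m,k,\lambda)$-SEDF in a finite abelian group $G$ of order $v$ with $m>2$, and let $D=\bigcup_{i=1}^mD_i$. For $\chi\in\widehat{G}^N$ let $$T_\chi=\Big\{\frac{4a_\chi^2\lambda}{b_\chi^2-a_\chi^2},\ \frac{(b_\chi+a_\chi)\lambda}{b_\chi-a_\chi},\ \frac{(b_\chi-a_\chi)\lambda}{b_\chi+a_\chi}\Big\},$$ and let $U_\chi=T_\chi$ if $|\widehat{G}^0|=0$ and $U_\chi=T_\chi\cup\{\lambda\}$ if $|\widehat{G}^0|>0$. Then for each $\chi\in\widehat{G}^N$ and each $u\in U_\chi$: if $q$ is a prime divisor of $u$ and $q$ is a primitive root modulo $p^s$, then $q^f\,\|\,u$ for some even $f$.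
   Context: Groups are finite abelian, written multiplicatively with identity $1$. For a subset $A\subseteq G$ we also write $A$ for $\sum_{a\in A}a\in\mathbb{Z}[G]$ and $A^{(-1)}=\sum_{a\in A}a^{-1}$. Given integers $m\ge 2$, $k\ge1$, $\lambda\ge 1$ and a group $G$ of order $v$, mutually disjoint $k$-subsets $D_1,\dots,D_m$ form a $(v,m,k,\lambda)$-SEDF in $G$ if $D_j\sum_{i\ne j}D_i^{(-1)}=\lambda(G-1)$ in $\mathbb{Z}[G]$ for each $j$; nontrivial means $k>1$. $\widehat{G}$ is the character group, characters extended linearly to $\mathbb{Z}[G]$. $\widehat{G}^0$ is the set of nonprincipal $\chi$ with $\chi(D)=0$, $\widehat{G}^N$ the set of nonprincipal $\chi$ with $\chi(D)\ne0$. For a nontrivial SEDF with $m>2$ and $\chi\in\widehat{G}^N$, $\sqrt{1+4\lambda/|\chi(D)|^2}$ is rational; write it $b_\chi/a_\chi$ with integers $b_\chi>a_\chi>0$, $\gcd(a_\chi,b_\chi)=1$. A prime $q$ is a primitive root modulo $n$ if it generates the multiplicative group of integers modulo $n$. $q^f\,\|\,u$ means $q^f\mid u$ and $q^{f+1}\nmid u$. *)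

theory Defs
  imports
    Complex_Main
    "HOL-Algebra.Coset"
    "HOL-Library.Disjoint_Sets"
    "HOL-Library.FuncSet"
    "HOL-Number_Theory.Residue_Primitive_Roots"
begin

(* Elements of Z[G] are represented by their coefficient functions, which vanish
   outside the carrier. Hence equality in Z[G] is equality of functions. *)

definition gr_set :: "'a set \<Rightarrow> 'a \<Rightarrow> int" where
  "gr_set A = (\<lambda>g. \<Sum>a\<in>A. of_bool (g = a))"

definition gr_set_inv :: "('a, 'b) monoid_scheme \<Rightarrow> 'a set \<Rightarrow> 'a \<Rightarrow> int" where
  "gr_set_inv G A = (\<lambda>g. \<Sum>a\<in>A. of_bool (g = inv\<^bsub>G\<^esub> a))"

definition gr_mult :: "('a, 'b) monoid_scheme \<Rightarrow> ('a \<Rightarrow> int) \<Rightarrow> ('a \<Rightarrow> int) \<Rightarrow> 'a \<Rightarrow> int" where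
  "gr_mult G x y =
     (\<lambda>g. \<Sum>(a, b)\<in>carrier G \<times> carrier G. of_bool (a \<otimes>\<^bsub>G\<^esub> b = g) * (x a * y b))"

definition is_sedf ::
    "('a, 'b) monoid_scheme \<Rightarrow> nat \<Rightarrow> nat \<Rightarrow> nat \<Rightarrow> nat \<Rightarrow> (nat \<Rightarrow> 'a set) \<Rightarrow> bool" where
  "is_sedf G v m k l D \<longleftrightarrow>
     comm_group G \<and> finite (carrier G) \<and> order G = v \<and>
     m \<ge> 2 \<and> k \<ge> 1 \<and> l \<ge> 1 \<and>
     (\<forall>i\<in>{1..m}. D i \<subseteq> carrier G \<and> card (D i) = k) \<and>
     disjoint_family_on D {1..m} \<and>
     (\<forall>j\<in>{1..m}.
        gr_mult G (gr_set (D j)) (\<lambda>g. \<Sum>i\<in>{1..m} - {j}. gr_set_inv G (D i) g)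
        = (\<lambda>g. int l * (gr_set (carrier G) g - gr_set {\<one>\<^bsub>G\<^esub>} g)))"

definition nontrivial_sedf ::
    "('a, 'b) monoid_scheme \<Rightarrow> nat \<Rightarrow> nat \<Rightarrow> nat \<Rightarrow> nat \<Rightarrow> (nat \<Rightarrow> 'a set) \<Rightarrow> bool" where
  "nontrivial_sedf G v m k l D \<longleftrightarrow> is_sedf G v m k l D \<and> k > 1"

definition complex_units :: "complex monoid" where
  "complex_units = \<lparr>carrier = UNIV - {0}, monoid.mult = (*), one = 1\<rparr>"

(* Extensionality makes a character determined by its values on the carrier, so
   that cardinalities of sets of characters are the intended ones. *)
definition characters :: "('a, 'b) monoid_scheme \<Rightarrow> ('a \<Rightarrow> complex) set" where
  "characters G = hom G complex_units \<inter> extensional (carrier G)"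

definition principal_char :: "('a, 'b) monoid_scheme \<Rightarrow> 'a \<Rightarrow> complex" where
  "principal_char G = (\<lambda>g\<in>carrier G. 1)"

definition char_ext :: "('a, 'b) monoid_scheme \<Rightarrow> ('a \<Rightarrow> complex) \<Rightarrow> ('a \<Rightarrow> int) \<Rightarrow> complex" where
  "char_ext G \<chi> x = (\<Sum>g\<in>carrier G. of_int (x g) * \<chi> g)"

definition chars_zero :: "('a, 'b) monoid_scheme \<Rightarrow> 'a set \<Rightarrow> ('a \<Rightarrow> complex) set" where
  "chars_zero G D =
     {\<chi> \<in> characters G. \<chi> \<noteq> principal_char G \<and> char_ext G \<chi> (gr_set D) = 0}"

definition chars_nonzero :: "('a, 'b) monoid_scheme \<Rightarrow> 'a set \<Rightarrow> ('a \<Rightarrow> complex) set" where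
  "chars_nonzero G D =
     {\<chi> \<in> characters G. \<chi> \<noteq> principal_char G \<and> char_ext G \<chi> (gr_set D) \<noteq> 0}"

definition lowest_terms :: "real \<Rightarrow> int \<Rightarrow> int \<Rightarrow> bool" where
  "lowest_terms r b a \<longleftrightarrow> b > a \<and> a > 0 \<and> gcd a b = 1 \<and> r = real_of_int b / real_of_int a"

definition chi_ratio ::
    "('a, 'b) monoid_scheme \<Rightarrow> nat \<Rightarrow> 'a set \<Rightarrow> ('a \<Rightarrow> complex) \<Rightarrow> real" where
  "chi_ratio G l D \<chi> = sqrt (1 + 4 * real l / (cmod (char_ext G \<chi> (gr_set D)))\<^sup>2)"

(* The integers a and b are meaningful only when chi_ratio is rational, which is the
   case for a nontrivial SEDF with m > 2 and a character in chars_nonzero. *)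
definition a_chi ::
    "('a, 'b) monoid_scheme \<Rightarrow> nat \<Rightarrow> 'a set \<Rightarrow> ('a \<Rightarrow> complex) \<Rightarrow> int" where
  "a_chi G l D \<chi> = (THE a. \<exists>b. lowest_terms (chi_ratio G l D \<chi>) b a)"

definition b_chi ::
    "('a, 'b) monoid_scheme \<Rightarrow> nat \<Rightarrow> 'a set \<Rightarrow> ('a \<Rightarrow> complex) \<Rightarrow> int" where
  "b_chi G l D \<chi> = (THE b. \<exists>a. lowest_terms (chi_ratio G l D \<chi>) b a)"

definition T_chi ::
    "('a, 'b) monoid_scheme \<Rightarrow> nat \<Rightarrow> 'a set \<Rightarrow> ('a \<Rightarrow> complex) \<Rightarrow> real set" where
  "T_chi G l D \<chi> =
     (let a = real_of_int (a_chi G l D \<chi>); b = real_of_int (b_chi G l D \<chi>) in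
      {4 * a\<^sup>2 * real l / (b\<^sup>2 - a\<^sup>2),
       (b + a) * real l / (b - a),
       (b - a) * real l / (b + a)})"

definition U_chi ::
    "('a, 'b) monoid_scheme \<Rightarrow> nat \<Rightarrow> 'a set \<Rightarrow> ('a \<Rightarrow> complex) \<Rightarrow> real set" where
  "U_chi G l D \<chi> =
     (if card (chars_zero G D) = 0 then T_chi G l D \<chi> else T_chi G l D \<chi> \<union> {real l})"

(* Divisibility in Z of a number u that is given as a real; u is then an integer.
   The library's dvd on real is trivial, because real is a field. *)
definition int_dvd :: "nat \<Rightarrow> real \<Rightarrow> bool" where
  "int_dvd d u \<longleftrightarrow> (\<exists>n::int. u = of_int (int d * n))"

definition exactly_divides :: "nat \<Rightarrow> nat \<Rightarrow> real \<Rightarrow> bool" where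
  "exactly_divides q f u \<longleftrightarrow> int_dvd (q ^ f) u \<and> \<not> int_dvd (q ^ (f + 1)) u"

end

(* All elements of U_chi have the form |psi(A)|^2 with psi a character and A a subset of G:
   with z = chi(D), the SEDF equations force chi(D_j) = (1 + e_j r) z / 2 for signs e_j and
   r = sqrt (1 + 4 lambda / |z|^2); summing over j gives r * (sum of the e_j) = 2 - m, so r is
   rational and both signs occur.  If psi(D) = 0, then |psi(D_j)|^2 = lambda.
   It remains to see that q divides u = x * cnj x to an even power when x is a sum of n-th roots
   of unity and q^j = -1 modulo n.  In place of the prime ideals of the cyclotomic ring R, the
   Frobenius map suffices: x^(q^j) = cnj x modulo q R, so if q divides x * cnj x then it divides
   x^(q^j + 1), hence x^(q^N) = x for a suitable large N.  Replace x by x / q and repeat. *)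
theory Submission
  imports Defs "Jordan_Normal_Form.Char_Poly"
begin

section \<open>The ring of sums of roots of unity\<close>

text \<open>For \<open>n > 0\<close> this is the ring R = Z[zeta_n], as an additive closure:
  induction adds or subtracts one root at a time, which suits the proofs about the Frobenius map.
  For \<open>n = 0\<close> every complex number satisfies \<open>z ^ n = 1\<close>, so the set is
  all of C.\<close>

inductive_set cyclo_int :: "nat \<Rightarrow> complex set" for n where
  zero: "0 \<in> cyclo_int n"
| add_root: "x \<in> cyclo_int n \<Longrightarrow> z ^ n = 1 \<Longrightarrow> x + z \<in> cyclo_int n"
| diff_root: "x \<in> cyclo_int n \<Longrightarrow> z ^ n = 1 \<Longrightarrow> x - z \<in> cyclo_int n"

lemma cyclo_int_add: "x + y \<in> cyclo_int n" if "x \<in> cyclo_int n" "y \<in> cyclo_int n"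
  using that(2)
proof induction
  case (add_root y z)
  then show ?case
    using cyclo_int.add_root[of "x + y" n z] by (simp add: add.assoc)
next
  case (diff_root y z)
  then show ?case
    using cyclo_int.diff_root[of "x + y" n z] by (simp add: algebra_simps)
qed (use that in simp)

lemma cyclo_int_diff: "x - y \<in> cyclo_int n" if "x \<in> cyclo_int n" "y \<in> cyclo_int n"
  using that(2)
proof induction
  case (add_root y z)
  then show ?case
    using cyclo_int.diff_root[of "x - y" n z] by (simp add: algebra_simps)
next
  case (diff_root y z)
  then show ?case
    using cyclo_int.add_root[of "x - y" n z] by (simp add: algebra_simps)
qed (use that in simp)

lemma cyclo_int_root: "z ^ n = 1 \<Longrightarrow> z \<in> cyclo_int n"
  using cyclo_int.add_root[OF cyclo_int.zero] by simp

lemma cyclo_int_mult_root: "x * w \<in> cyclo_int n" if "x \<in> cyclo_int n" "w ^ n = 1"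
  using that(1)
proof induction
  case zero
  then show ?case by (simp add: cyclo_int.zero)
next
  case (add_root x z)
  then show ?case
    using cyclo_int.add_root[of "x * w" n "z * w"] that(2)
    by (simp add: algebra_simps power_mult_distrib)
next
  case (diff_root x z)
  then show ?case
    using cyclo_int.diff_root[of "x * w" n "z * w"] that(2)
    by (simp add: algebra_simps power_mult_distrib)
qed

lemma cyclo_int_mult: "x * y \<in> cyclo_int n" if "x \<in> cyclo_int n" "y \<in> cyclo_int n"
  using that(2)
proof induction
  case zero
  then show ?case by (simp add: cyclo_int.zero)
next
  case (add_root y z)
  then show ?case
    using cyclo_int_add cyclo_int_mult_root[OF that(1)] by (simp add: distrib_left)
next
  case (diff_root y z)
  then show ?case
    using cyclo_int_diff cyclo_int_mult_root[OF that(1)] by (simp add: right_diff_distrib)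
qed

lemma cyclo_int_one: "1 \<in> cyclo_int n"
  by (simp add: cyclo_int_root)

lemma cyclo_int_power: "x \<in> cyclo_int n \<Longrightarrow> x ^ k \<in> cyclo_int n"
  by (induction k) (auto intro: cyclo_int_one cyclo_int_mult)

lemma cyclo_int_sum: "(\<And>i. i \<in> A \<Longrightarrow> f i \<in> cyclo_int n) \<Longrightarrow> sum f A \<in> cyclo_int n"
  by (induction A rule: infinite_finite_induct) (auto intro: cyclo_int.zero cyclo_int_add)

lemma cyclo_int_of_nat: "of_nat k \<in> cyclo_int n"
  by (induction k) (auto intro: cyclo_int.zero cyclo_int_add cyclo_int_one)

lemma cyclo_int_of_int: "of_int k \<in> cyclo_int n"
  by (cases k rule: int_diff_cases) (auto intro: cyclo_int_diff cyclo_int_of_nat)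

lemma cyclo_int_cnj: "x \<in> cyclo_int n \<Longrightarrow> cnj x \<in> cyclo_int n"
proof (induction rule: cyclo_int.induct)
  case (add_root x z)
  then show ?case
    using cyclo_int.add_root[of "cnj x" n "cnj z"] by (simp flip: complex_cnj_power)
next
  case (diff_root x z)
  then show ?case
    using cyclo_int.diff_root[of "cnj x" n "cnj z"] by (simp flip: complex_cnj_power)
qed (simp add: cyclo_int.zero)

section \<open>Integrality over Z\<close>

text \<open>Provides the rows of the integer matrix used for integrality. The coefficients are not
  unique for \<open>n > 1\<close>, where the roots sum to 0; existence suffices.\<close>

lemma cyclo_int_coeffs:
  assumes "n > 0" "x \<in> cyclo_int n"
  shows "\<exists>c. x = (\<Sum>i<n. of_int (c i) * cis (2 * pi * real i / real n))"
  using assms(2)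
proof induction
  case zero
  show ?case by (rule exI[of _ "\<lambda>_. 0"]) simp
next
  case (add_root x z)
  obtain c where c: "x = (\<Sum>i<n. of_int (c i) * cis (2 * pi * real i / real n))"
    using add_root by blast
  obtain k where k: "k < n" "z = cis (2 * pi * real k / real n)"
    using bij_betw_roots_unity[OF assms(1)] add_root(2) unfolding bij_betw_def by blast
  let ?d = "\<lambda>i. c i + of_bool (i = k)"
  have "x + z = (\<Sum>i<n. of_int (?d i) * cis (2 * pi * real i / real n))"
    using k by (simp add: c distrib_right sum.distrib sum_of_bool_mult_eq)
  then show ?case by (rule exI[of _ ?d])
next
  case (diff_root x z)
  obtain c where c: "x = (\<Sum>i<n. of_int (c i) * cis (2 * pi * real i / real n))"
    using diff_root by blast
  obtain k where k: "k < n" "z = cis (2 * pi * real k / real n)"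
    using bij_betw_roots_unity[OF assms(1)] diff_root(2) unfolding bij_betw_def by blast
  let ?d = "\<lambda>i. c i - of_bool (i = k)"
  have "x - z = (\<Sum>i<n. of_int (?d i) * cis (2 * pi * real i / real n))"
    using k by (simp add: c left_diff_distrib sum_subtractf sum_of_bool_mult_eq)
  then show ?case by (rule exI[of _ ?d])
qed

(* Multiplication by x acts on the span of the n-th roots of unity by an integer matrix, with the
   vector of these roots as an eigenvector for the eigenvalue x. *)
lemma algebraic_int_cyclo_int:
  assumes n: "n > 0" and x: "x \<in> cyclo_int n"
  shows "algebraic_int x"
proof -
  define \<zeta> where "\<zeta> i = cis (2 * pi * real i / real n)" for i :: nat
  have root: "\<zeta> i ^ n = 1" for i
    using n by (simp add: \<zeta>_def DeMoivre cis_multiple_2pi)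
  have "\<exists>c. x * \<zeta> i = (\<Sum>j<n. of_int (c j) * \<zeta> j)" for i
    unfolding \<zeta>_def using cyclo_int_coeffs[OF n cyclo_int_mult_root[OF x root]] by (simp add: \<zeta>_def)
  then obtain c where c: "x * \<zeta> i = (\<Sum>j<n. of_int (c i j) * \<zeta> j)" for i
    by metis
  define A :: "int mat" where "A = Matrix.mat n n (\<lambda>(i, j). c i j)"
  define B :: "complex mat" where "B = map_mat of_int A"
  have A: "A \<in> carrier_mat n n" and B: "B \<in> carrier_mat n n"
    by (simp_all add: A_def B_def)
  have "B *\<^sub>v Matrix.vec n \<zeta> = x \<cdot>\<^sub>v Matrix.vec n \<zeta>"
    by (rule eq_vecI)
      (use c in \<open>simp_all add: A_def B_def scalar_prod_def atLeast0LessThan\<close>)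
  moreover have "Matrix.vec n \<zeta> \<noteq> 0\<^sub>v n"
  proof
    assume "Matrix.vec n \<zeta> = 0\<^sub>v n"
    then have "Matrix.vec n \<zeta> $ 0 = 0\<^sub>v n $ 0" by simp
    then show False using n by (simp add: \<zeta>_def)
  qed
  ultimately have "eigenvector B (Matrix.vec n \<zeta>) x"
    using B by (auto simp: eigenvector_def)
  then have "poly (char_poly B) x = 0"
    using eigenvalue_root_char_poly[OF B] by (auto simp: eigenvalue_def)
  moreover have "char_poly B = map_poly of_int (char_poly A)"
    unfolding B_def by (rule of_int_hom.char_poly_hom[OF A])
  moreover have "lead_coeff (char_poly A) = 1"
    using degree_monic_char_poly[OF A] by simp
  ultimately show ?thesis
    unfolding algebraic_int_altdef_ipoly by metis
qed

section \<open>The Frobenius map modulo q\<close>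

text \<open>Congruences modulo c R survive powers because x - y divides x^k - y^k. Here and below,
  such a congruence is written as membership of the quotient by c in R.\<close>

lemma cyclo_int_power_diff:
  assumes "x \<in> cyclo_int n" "y \<in> cyclo_int n" "(x - y) / c \<in> cyclo_int n"
  shows "(x ^ k - y ^ k) / c \<in> cyclo_int n"
proof -
  have "(x ^ k - y ^ k) / c = (x - y) / c * (\<Sum>i<k. y ^ (k - Suc i) * x ^ i)"
    by (simp only: power_diff_sumr2 times_divide_eq_left)
  also have "\<dots> \<in> cyclo_int n"
    by (intro cyclo_int_mult cyclo_int_sum cyclo_int_power assms)
  finally show ?thesis .
qed

text \<open>The prime q divides every binomial coefficient strictly between the two ends of the
  expansion.\<close>

lemma cyclo_int_freshmans_dream:
  assumes q: "prime q" and x: "x \<in> cyclo_int n" and y: "y \<in> cyclo_int n"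
  shows "((x + y) ^ q - x ^ q - y ^ q) / of_nat q \<in> cyclo_int n"
proof -
  have q0: "q > 1" using q by (rule prime_gt_1_nat)
  have "(x + y) ^ q = (\<Sum>k\<le>q. of_nat (q choose k) * x ^ k * y ^ (q - k))"
    by (rule binomial_ring)
  also have "{..q} = insert 0 (insert q {0<..<q})"
    using q0 by auto
  also have "(\<Sum>k\<in>\<dots>. of_nat (q choose k) * x ^ k * y ^ (q - k))
      = y ^ q + x ^ q + (\<Sum>k\<in>{0<..<q}. of_nat (q choose k) * x ^ k * y ^ (q - k))"
    using q0 by simp
  finally have "((x + y) ^ q - x ^ q - y ^ q) / of_nat q
      = (\<Sum>k\<in>{0<..<q}. of_nat (q choose k) * x ^ k * y ^ (q - k) / of_nat q)"
    by (simp add: sum_divide_distrib)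
  also have "\<dots> = (\<Sum>k\<in>{0<..<q}. of_nat ((q choose k) div q) * x ^ k * y ^ (q - k))"
  proof (rule sum.cong[OF refl])
    fix k assume k: "k \<in> {0<..<q}"
    have "q dvd (q choose k)"
      using k q by (intro dvd_choose_prime) auto
    then obtain d where "q choose k = q * d" ..
    then show "of_nat (q choose k) * x ^ k * y ^ (q - k) / of_nat q
        = of_nat ((q choose k) div q) * x ^ k * y ^ (q - k)"
      using q0 by simp
  qed
  also have "\<dots> \<in> cyclo_int n"
    by (intro cyclo_int_sum cyclo_int_mult cyclo_int_of_nat cyclo_int_power x y)
  finally show ?thesis .
qed

lemma cyclo_int_freshmans_dream_iter:
  assumes q: "prime q" and x: "x \<in> cyclo_int n" and y: "y \<in> cyclo_int n"
  shows "((x + y) ^ (q ^ j) - x ^ (q ^ j) - y ^ (q ^ j)) / of_nat q \<in> cyclo_int n"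
proof (induction j)
  case 0
  then show ?case by (simp add: cyclo_int.zero)
next
  case (Suc j)
  let ?X = "x ^ (q ^ j)" and ?Y = "y ^ (q ^ j)" and ?Z = "(x + y) ^ (q ^ j)"
  \<comment> \<open>The induction hypothesis says \<open>?Z\<close> is congruent to
    \<open>?X + ?Y\<close>; raise this to the q-th power, then expand the right side once
    more.\<close>
  have "(?Z ^ q - (?X + ?Y) ^ q) / of_nat q \<in> cyclo_int n"
    by (rule cyclo_int_power_diff)
      (use Suc x y in \<open>auto intro: cyclo_int_power cyclo_int_add simp: diff_diff_eq\<close>)
  moreover have "((?X + ?Y) ^ q - ?X ^ q - ?Y ^ q) / of_nat q \<in> cyclo_int n"
    by (intro cyclo_int_freshmans_dream q cyclo_int_power x y)
  ultimately have "(?Z ^ q - (?X + ?Y) ^ q) / of_nat q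
      + ((?X + ?Y) ^ q - ?X ^ q - ?Y ^ q) / of_nat q \<in> cyclo_int n"
    by (rule cyclo_int_add)
  moreover have "w ^ (q ^ Suc j) = (w ^ (q ^ j)) ^ q" for w :: complex
    by (simp add: mult.commute flip: power_mult)
  ultimately show ?case
    by (simp add: algebra_simps del: power_Suc flip: add_divide_distrib)
qed

text \<open>Modulo q the power map is additive, so it agrees with any additive \<open>h\<close> as
  soon as it does on the roots. The instances used are complex conjugation and the identity.\<close>

lemma cyclo_int_frobenius:
  assumes q: "prime q" and x: "x \<in> cyclo_int n"
    and h0: "h 0 = 0" and hadd: "\<And>x y. h (x + y) = h x + h y"
    and root: "\<And>z. z ^ n = 1 \<Longrightarrow> z ^ (q ^ j) = h z"
  shows "(x ^ (q ^ j) - h x) / of_nat q \<in> cyclo_int n"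
  using x
proof induction
  case zero
  have "q > 0" using q by (rule prime_gt_0_nat)
  then show ?case by (simp add: cyclo_int.zero h0 power_0_left)
next
  case (add_root x z)
  have "((x + z) ^ (q ^ j) - x ^ (q ^ j) - z ^ (q ^ j)) / of_nat q \<in> cyclo_int n"
    by (intro cyclo_int_freshmans_dream_iter q add_root cyclo_int_root)
  from cyclo_int_add[OF this add_root.IH] show ?case
    by (simp add: root[OF add_root(2)] hadd diff_diff_eq add.commute flip: add_divide_distrib)
next
  case (diff_root x z)
  have eq: "h (x - z) = h x - h z"
    using hadd[of "x - z" z] by simp
  \<comment> \<open>Expanding x as (x - z) + z avoids the sign of (-z)^(q^j), which depends on the
    parity of q.\<close>
  have "((x - z + z) ^ (q ^ j) - (x - z) ^ (q ^ j) - z ^ (q ^ j)) / of_nat q \<in> cyclo_int n"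
    by (intro cyclo_int_freshmans_dream_iter q cyclo_int.diff_root diff_root cyclo_int_root)
  from cyclo_int_diff[OF diff_root.IH this] show ?case
    by (simp add: root[OF diff_root(2)] eq algebra_simps flip: diff_divide_distrib)
qed

section \<open>Even exponents when -1 is a power of q modulo n\<close>

lemma root_unity_mult_cnj:
  fixes z :: complex
  assumes "n > 0" "z ^ n = 1"
  shows "z * cnj z = 1"
proof -
  have "norm z = 1"
    using assms by (metis norm_one norm_power power_eq_1_iff norm_ge_zero abs_norm_cancel less_numeral_extra(3))
  then show ?thesis by (simp add: complex_norm_square[symmetric])
qed

lemma root_unity_power_mod:
  fixes z :: complex
  assumes "z ^ n = 1" "[a = b] (mod n)"
  shows "z ^ a = z ^ b"
proof -
  have *: "z ^ a = z ^ (a mod n)" for a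
    using assms(1) by (metis mult_1 power_add power_mult power_one mult_div_mod_eq)
  show ?thesis
    using assms(2) *[of a] *[of b] by (simp add: cong_def)
qed

text \<open>Modulo q one power of Frobenius is complex conjugation and another is the identity. The
  first turns divisibility of the norm into divisibility of a power of x, the second brings it back
  to x.\<close>

lemma cyclo_int_dvd_of_norm_dvd:
  assumes q: "prime q" and n: "n > 0" and coprime: "coprime q n" and j: "n dvd q ^ j + 1" and x: "x \<in> cyclo_int n"
    and norm: "x * cnj x / of_nat q \<in> cyclo_int n"
  shows "x / of_nat q \<in> cyclo_int n"
proof -
  have q1: "q > 1" using q by (rule prime_gt_1_nat)
  have "(x ^ (q ^ j) - cnj x) / of_nat q \<in> cyclo_int n"
  proof (rule cyclo_int_frobenius[OF q x])
    fix z :: complex assume z: "z ^ n = 1"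
    from n z have "z * cnj z = 1" by (rule root_unity_mult_cnj)
    \<comment> \<open>Since q^j is -1 modulo n, \<open>z ^ (q ^ j)\<close> is the inverse of z,
      hence its conjugate.\<close>
    moreover have "z * z ^ (q ^ j) = 1"
      using root_unity_power_mod[OF z, of "q ^ j + 1" 0] j by (simp add: cong_0_iff)
    ultimately show "z ^ (q ^ j) = cnj z"
      by (metis mult_cancel_left mult_zero_left zero_neq_one)
  qed auto
  then have "x * ((x ^ (q ^ j) - cnj x) / of_nat q) + x * cnj x / of_nat q \<in> cyclo_int n"
    by (intro cyclo_int_add cyclo_int_mult x norm)
  then have a: "x ^ (q ^ j + 1) / of_nat q \<in> cyclo_int n"
    by (simp add: right_diff_distrib flip: add_divide_distrib)

  \<comment> \<open>The exponent \<open>t * (j + 1)\<close> is a multiple of the totient, so this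
    power of Frobenius fixes all roots. The factor \<open>j + 1\<close> makes
    \<open>q ^ (t * (j + 1))\<close> at least \<open>q ^ j + 1\<close>, so that the divisible power
    of x can be split off.\<close>
  define t where "t = totient n"
  from coprime have cong: "[q ^ (t * (j + 1)) = 1] (mod n)"
    using cong_pow[OF euler_theorem, of q n "j + 1"] by (simp only: t_def power_mult power_one)
  have "t > 0" using n by (simp add: t_def)
  then have "j + 1 \<le> t * (j + 1)"
    using mult_le_mono1[of 1 t "j + 1"] by simp
  then have "q ^ (j + 1) \<le> q ^ (t * (j + 1))"
    using q1 by (intro power_increasing) auto
  moreover have "q ^ j + 1 \<le> q ^ (j + 1)"
    using q1 by (metis Suc_eq_plus1 Suc_leI power_strict_increasing lessI)
  ultimately have le: "q ^ j + 1 \<le> q ^ (t * (j + 1))" by linarith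
  have "x ^ (q ^ (t * (j + 1))) / of_nat q
      = x ^ (q ^ j + 1) / of_nat q * x ^ (q ^ (t * (j + 1)) - (q ^ j + 1))"
    using le by (metis le_add_diff_inverse power_add times_divide_eq_left)
  also have "\<dots> \<in> cyclo_int n"
    by (intro cyclo_int_mult a cyclo_int_power x)
  finally have b: "x ^ (q ^ (t * (j + 1))) / of_nat q \<in> cyclo_int n" .
  have "(x ^ (q ^ (t * (j + 1))) - x) / of_nat q \<in> cyclo_int n"
    by (rule cyclo_int_frobenius[OF q x])
      (use root_unity_power_mod[OF _ cong] in auto)
  from cyclo_int_diff[OF b this] show ?thesis
    by (simp flip: diff_divide_distrib)
qed

text \<open>Descent: whenever q divides u, it divides x, and replacing x by x / q lowers the
  multiplicity by exactly 2.\<close>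

lemma even_multiplicity_cyclo_int_norm:
  assumes q: "prime q" and n: "n > 0" and coprime: "coprime q n" and j: "n dvd q ^ j + 1"
    and "x \<in> cyclo_int n" "x * cnj x = of_int u" "u \<noteq> 0"
  shows "even (multiplicity (int q) u)"
  using assms(5-7)
proof (induction "multiplicity (int q) u" arbitrary: x u rule: less_induct)
  case less
  have q1: "q > 1" using q by (rule prime_gt_1_nat)
  show ?case
  proof (cases "int q dvd u")
    case False
    then show ?thesis by (simp add: not_dvd_imp_multiplicity_0)
  next
    case True
    then obtain d where d: "u = int q * d" ..
    have "x * cnj x / of_nat q = of_int d"
      using less.prems(2) q1 by (simp add: d)
    then have y: "x / of_nat q \<in> cyclo_int n" (is "?y \<in> _")
      using cyclo_int_dvd_of_norm_dvd[OF q n coprime j less.prems(1)] cyclo_int_of_int by simp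
    have yu: "?y * cnj ?y = of_int u / of_nat (q * q)"
      using less.prems(2) by simp
    \<comment> \<open>The new norm u / q^2 is rational and an algebraic integer, hence an integer
      \<open>w\<close>, to which the induction hypothesis applies.\<close>
    then have "?y * cnj ?y \<in> \<rat>"
      by (simp only: Rats_divide Rats_of_int Rats_of_nat)
    moreover have "algebraic_int (?y * cnj ?y)"
      by (intro algebraic_int_cyclo_int[OF n] cyclo_int_mult cyclo_int_cnj y)
    ultimately obtain w where w: "?y * cnj ?y = of_int w"
      using rational_algebraic_int_is_int Ints_cases by blast
    have "(of_int u :: complex) = of_int (int q * (int q * w))"
      using yu w q1 by (simp add: field_simps)
    then have u: "u = int q * (int q * w)" by (simp only: of_int_eq_iff)
    have w0: "w \<noteq> 0" using u less.prems(3) by auto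
    have "multiplicity (int q) u = Suc (Suc (multiplicity (int q) w))"
      unfolding u using q1 w0 by (simp add: multiplicity_times_same)
    moreover from this have "even (multiplicity (int q) w)"
      using less.hyps[OF _ y w w0] by simp
    ultimately show ?thesis by simp
  qed
qed

section \<open>Characters on the group ring\<close>

context
  fixes G :: "('a, 'b) monoid_scheme" and \<chi> :: "'a \<Rightarrow> complex"
  assumes G: "comm_group G" and fin: "finite (carrier G)" and \<chi>: "\<chi> \<in> characters G"
begin

interpretation comm_group G by (fact G)

lemma char_mult: "g \<in> carrier G \<Longrightarrow> h \<in> carrier G \<Longrightarrow> \<chi> (g \<otimes>\<^bsub>G\<^esub> h) = \<chi> g * \<chi> h"
  using \<chi> by (auto simp: characters_def hom_def complex_units_def)

lemma char_nonzero: "g \<in> carrier G \<Longrightarrow> \<chi> g \<noteq> 0"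
  using \<chi> by (auto simp: characters_def hom_def complex_units_def)

lemma char_one: "\<chi> \<one>\<^bsub>G\<^esub> = 1"
  using char_mult[of "\<one>\<^bsub>G\<^esub>" "\<one>\<^bsub>G\<^esub>"] char_nonzero[of "\<one>\<^bsub>G\<^esub>"] by simp

lemma char_pow: "g \<in> carrier G \<Longrightarrow> \<chi> (g [^]\<^bsub>G\<^esub> (n::nat)) = \<chi> g ^ n"
  by (induction n) (simp_all add: char_one char_mult)

lemma char_pow_order: "g \<in> carrier G \<Longrightarrow> \<chi> g ^ Coset.order G = 1"
  by (metis char_pow char_one pow_order_eq_1)

text \<open>Character values are roots of unity because the group is finite, so inverse and
  conjugate coincide.\<close>

lemma char_inv: "\<chi> (inv\<^bsub>G\<^esub> g) = cnj (\<chi> g)" if g: "g \<in> carrier G"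
proof -
  have "\<chi> g * \<chi> (inv\<^bsub>G\<^esub> g) = 1"
    using char_mult[of g "inv\<^bsub>G\<^esub> g"] g by (simp add: char_one)
  moreover have "\<chi> g * cnj (\<chi> g) = 1"
    using char_pow_order[OF g] fin order_gt_0_iff_finite by (intro root_unity_mult_cnj) auto
  ultimately show ?thesis
    by (metis mult_cancel_left mult_zero_left zero_neq_one)
qed

text \<open>Translation by an h with \<open>\<chi> h\<close> different from 1 permutes the carrier
  and multiplies the sum by \<open>\<chi> h\<close>. Such an h exists because extensionality makes a
  character that is 1 on the carrier equal to \<open>principal_char G\<close>.\<close>

lemma sum_char_eq_0:
  assumes "\<chi> \<noteq> principal_char G"
  shows "(\<Sum>g\<in>carrier G. \<chi> g) = 0"
proof -
  have "\<exists>h\<in>carrier G. \<chi> h \<noteq> 1"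
  proof (rule ccontr)
    assume "\<not> ?thesis"
    then have "\<chi> = principal_char G"
      using \<chi> by (auto simp: characters_def principal_char_def extensional_def restrict_def)
    with assms show False ..
  qed
  then obtain h where h: "h \<in> carrier G" "\<chi> h \<noteq> 1" ..
  have "(\<Sum>g\<in>carrier G. \<chi> g) = (\<Sum>g\<in>carrier G. \<chi> (h \<otimes>\<^bsub>G\<^esub> g))"
  proof (rule sum.reindex_bij_witness[of _ "\<lambda>g. h \<otimes>\<^bsub>G\<^esub> g" "\<lambda>g. inv\<^bsub>G\<^esub> h \<otimes>\<^bsub>G\<^esub> g"])
  qed (use h in \<open>simp_all add: m_assoc[symmetric]\<close>)
  also have "\<dots> = \<chi> h * (\<Sum>g\<in>carrier G. \<chi> g)"
    using h by (simp add: char_mult sum_distrib_left)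
  finally show ?thesis using h(2) by simp
qed

lemma char_ext_gr_set:
  assumes "A \<subseteq> carrier G"
  shows "char_ext G \<chi> (gr_set A) = (\<Sum>a\<in>A. \<chi> a)"
proof -
  have "finite A" using assms fin by (rule finite_subset)
  then have "gr_set A g = of_bool (g \<in> A)" for g
    by (simp add: gr_set_def sum.delta of_bool_def)
  then have "char_ext G \<chi> (gr_set A) = (\<Sum>g\<in>carrier G. of_bool (g \<in> A) * \<chi> g)"
    by (simp add: char_ext_def)
  also have "\<dots> = (\<Sum>a\<in>A. \<chi> a)"
    using assms fin by (simp add: sum_of_bool_mult_eq Int_absorb1)
  finally show ?thesis .
qed

lemma char_ext_gr_set_inv:
  assumes A: "A \<subseteq> carrier G"
  shows "char_ext G \<chi> (gr_set_inv G A) = cnj (\<Sum>a\<in>A. \<chi> a)"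
proof -
  have "char_ext G \<chi> (gr_set_inv G A)
      = (\<Sum>a\<in>A. \<Sum>g\<in>carrier G. of_bool (g = inv\<^bsub>G\<^esub> a) * \<chi> g)"
    unfolding char_ext_def gr_set_inv_def
    by (simp add: sum_distrib_right) (rule sum.swap)
  also have "\<dots> = (\<Sum>a\<in>A. \<chi> (inv\<^bsub>G\<^esub> a))"
  proof (rule sum.cong[OF refl])
    fix a assume "a \<in> A"
    then have "inv\<^bsub>G\<^esub> a \<in> carrier G" using A by auto
    then show "(\<Sum>g\<in>carrier G. of_bool (g = inv\<^bsub>G\<^esub> a) * \<chi> g) = \<chi> (inv\<^bsub>G\<^esub> a)"
      using fin by (simp add: sum_of_bool_mult_eq)
  qed
  also have "\<dots> = (\<Sum>a\<in>A. cnj (\<chi> a))"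
    using A by (intro sum.cong) (auto simp: char_inv)
  finally show ?thesis by simp
qed

lemma char_ext_sum: "char_ext G \<chi> (\<lambda>g. \<Sum>i\<in>I. x i g) = (\<Sum>i\<in>I. char_ext G \<chi> (x i))"
  unfolding char_ext_def by (simp add: sum_distrib_right) (rule sum.swap)

text \<open>After exchanging the sums, each pair (a, b) contributes only at g = ab, where the
  character splits.\<close>

lemma char_ext_mult: "char_ext G \<chi> (gr_mult G x y) = char_ext G \<chi> x * char_ext G \<chi> y"
proof -
  let ?P = "carrier G \<times> carrier G"
  have "char_ext G \<chi> (gr_mult G x y)
      = (\<Sum>g\<in>carrier G. \<Sum>(a, b)\<in>?P. of_bool (g = a \<otimes>\<^bsub>G\<^esub> b) * (of_int (x a * y b) * \<chi> g))"
    unfolding char_ext_def gr_mult_def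
    by (auto simp: sum_distrib_right case_prod_unfold mult.assoc eq_commute intro!: sum.cong)
  also have "\<dots> = (\<Sum>(a, b)\<in>?P. \<Sum>g\<in>carrier G. of_bool (g = a \<otimes>\<^bsub>G\<^esub> b) * (of_int (x a * y b) * \<chi> g))"
    unfolding case_prod_unfold by (rule sum.swap)
  also have "\<dots> = (\<Sum>(a, b)\<in>?P. (of_int (x a) * \<chi> a) * (of_int (y b) * \<chi> b))"
  proof (intro sum.cong[OF refl], clarify)
    fix a b assume ab: "a \<in> carrier G" "b \<in> carrier G"
    then show "(\<Sum>g\<in>carrier G. of_bool (g = a \<otimes>\<^bsub>G\<^esub> b) * (of_int (x a * y b) * \<chi> g))
        = (of_int (x a) * \<chi> a) * (of_int (y b) * \<chi> b)"
      using fin by (simp add: sum_of_bool_mult_eq char_mult)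
  qed
  also have "\<dots> = char_ext G \<chi> x * char_ext G \<chi> y"
    by (simp add: char_ext_def sum_product sum.cartesian_product)
  finally show ?thesis .
qed

end

section \<open>Reduced fractions\<close>

lemma lowest_terms_exists:
  assumes "r \<in> \<rat>" "r > 1"
  shows "\<exists>b a. lowest_terms r b a"
proof -
  obtain a b :: int where ab: "b > 0" "coprime a b" "r = of_int a / of_int b"
    using assms(1) by (rule Rats_cases')
  with assms(2) have "a > b" by (simp add: field_simps)
  with ab have "lowest_terms r a b"
    by (simp add: lowest_terms_def gcd.commute)
  then show ?thesis by blast
qed

lemma lowest_terms_unique:
  assumes "lowest_terms r b a" "lowest_terms r b' a'"
  shows "a = a'" "b = b'"
proof -
  from assms have pos: "a > 0" "a' > 0" "b > 0" "b' > 0"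
    and cop: "coprime a b" "coprime a' b'"
    and eq: "real_of_int b / real_of_int a = real_of_int b' / real_of_int a'"
    by (auto simp: lowest_terms_def coprime_iff_gcd_eq_1)
  have "real_of_int (b * a') = real_of_int (b' * a)"
    using eq pos by (simp add: field_simps)
  then have *: "b * a' = b' * a" by (simp only: of_int_eq_iff)
  then have "a dvd a'" "a' dvd a"
    using cop by (metis coprime_dvd_mult_right_iff dvd_triv_right)+
  then show "a = a'" using pos by (simp add: zdvd_antisym_nonneg)
  with * pos show "b = b'" by simp
qed

text \<open>Discharges the definite descriptions in \<open>a_chi\<close> and \<open>b_chi\<close>: a
  rational ratio above 1 has exactly one reduced form.\<close>

lemma lowest_terms_chi:
  assumes "chi_ratio G l D \<chi> \<in> \<rat>" "chi_ratio G l D \<chi> > 1"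
  shows "lowest_terms (chi_ratio G l D \<chi>) (b_chi G l D \<chi>) (a_chi G l D \<chi>)"
proof -
  obtain b a where ba: "lowest_terms (chi_ratio G l D \<chi>) b a"
    using lowest_terms_exists[OF assms] by blast
  then have "a_chi G l D \<chi> = a" "b_chi G l D \<chi> = b"
    unfolding a_chi_def b_chi_def by (blast intro: the_equality lowest_terms_unique)+
  with ba show ?thesis by simp
qed

section \<open>Character values of the sets of an SEDF\<close>

text \<open>Apply the character to the SEDF equation. Inverses become conjugates, the union of the
  other sets becomes D - D_j, and G - 1 goes to 0 - 1.\<close>

lemma sedf_char_values:
  assumes sedf: "is_sedf G v m k l D" and \<chi>: "\<chi> \<in> characters G" "\<chi> \<noteq> principal_char G"
    and j: "j \<in> {1..m}"
  defines "x \<equiv> \<lambda>A. char_ext G \<chi> (gr_set A)"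
  shows "x (\<Union>i\<in>{1..m}. D i) = (\<Sum>i\<in>{1..m}. x (D i))"
    and "x (D j) * cnj (x (\<Union>i\<in>{1..m}. D i) - x (D j)) = - of_nat l"
proof -
  from sedf have G: "comm_group G" and fin: "finite (carrier G)"
    and D: "\<And>i. i \<in> {1..m} \<Longrightarrow> D i \<subseteq> carrier G"
    and disj: "disjoint_family_on D {1..m}"
    and eq: "gr_mult G (gr_set (D j)) (\<lambda>g. \<Sum>i\<in>{1..m} - {j}. gr_set_inv G (D i) g)
        = (\<lambda>g. int l * (gr_set (carrier G) g - gr_set {\<one>\<^bsub>G\<^esub>} g))"
    using j by (auto simp: is_sedf_def)
  interpret comm_group G by (fact G)
  note set = char_ext_gr_set[OF G fin \<chi>(1)]
  have "x (\<Union>i\<in>{1..m}. D i) = (\<Sum>a\<in>(\<Union>i\<in>{1..m}. D i). \<chi> a)"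
    using D unfolding x_def by (intro set) blast
  also have "\<dots> = (\<Sum>i\<in>{1..m}. \<Sum>a\<in>D i. \<chi> a)"
    using finite_subset[OF D fin] disj
    by (intro sum.UNION_disjoint) (auto simp: disjoint_family_on_def)
  also have "\<dots> = (\<Sum>i\<in>{1..m}. x (D i))"
    using D by (simp add: x_def set)
  finally show union: "x (\<Union>i\<in>{1..m}. D i) = (\<Sum>i\<in>{1..m}. x (D i))" .
  then have diff: "x (\<Union>i\<in>{1..m}. D i) - x (D j) = (\<Sum>i\<in>{1..m} - {j}. x (D i))"
    using j by (simp add: sum_diff1)
  have "char_ext G \<chi> (gr_set (D j)) * (\<Sum>i\<in>{1..m} - {j}. char_ext G \<chi> (gr_set_inv G (D i)))
      = char_ext G \<chi> (\<lambda>g. int l * (gr_set (carrier G) g - gr_set {\<one>\<^bsub>G\<^esub>} g))"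
    by (simp only: eq[symmetric] char_ext_mult[OF G fin \<chi>(1)] char_ext_sum[OF G fin \<chi>(1)])
  also have "(\<Sum>i\<in>{1..m} - {j}. char_ext G \<chi> (gr_set_inv G (D i))) = cnj (\<Sum>i\<in>{1..m} - {j}. x (D i))"
    using D by (simp add: char_ext_gr_set_inv[OF G fin \<chi>(1)] x_def set)
  also have "char_ext G \<chi> (\<lambda>g. int l * (gr_set (carrier G) g - gr_set {\<one>\<^bsub>G\<^esub>} g))
      = of_nat l * (char_ext G \<chi> (gr_set (carrier G)) - char_ext G \<chi> (gr_set {\<one>\<^bsub>G\<^esub>}))"
    by (simp add: char_ext_def sum_distrib_left sum_subtractf[symmetric] algebra_simps)
  also have "\<dots> = - of_nat l"
    using set[of "carrier G"] set[of "{\<one>\<^bsub>G\<^esub>}"]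
    by (simp add: sum_char_eq_0[OF G fin \<chi>] char_one[OF G fin \<chi>(1)])
  finally show "x (D j) * cnj (x (\<Union>i\<in>{1..m}. D i) - x (D j)) = - of_nat l"
    unfolding diff by (simp add: x_def)
qed

text \<open>Each x_j is a real multiple t_j of z with t_j^2 - t_j = l / |z|^2, so t_j = (1 + e_j r)
  / 2 with a sign e_j. As the t_j sum to 1, the sum E of the signs satisfies E r = 2 - m, which
  makes r rational and forces both signs to occur.\<close>

lemma balanced_values:
  fixes x :: "nat \<Rightarrow> complex"
  assumes m: "m > 2" and l: "l \<ge> (1::nat)" and z0: "z \<noteq> 0" and z: "z = (\<Sum>i\<in>{1..m}. x i)"
    and eq: "\<And>j. j \<in> {1..m} \<Longrightarrow> x j * cnj (z - x j) = - of_nat l"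
  defines "r \<equiv> sqrt (1 + 4 * real l / (cmod z)\<^sup>2)"
  shows "r > 1" "r \<in> \<rat>"
    and "\<exists>j\<in>{1..m}. (cmod (x j))\<^sup>2 = (1 + r)\<^sup>2 / 4 * (cmod z)\<^sup>2"
    and "\<exists>j\<in>{1..m}. (cmod (x j))\<^sup>2 = (1 - r)\<^sup>2 / 4 * (cmod z)\<^sup>2"
proof -
  define w where "w = (cmod z)\<^sup>2"
  have w: "w > 0" using z0 by (simp add: w_def)
  have r2: "r\<^sup>2 = 1 + 4 * real l / w"
    unfolding r_def w_def[symmetric] using w by (subst real_sqrt_pow2) auto
  show r1: "r > 1"
    unfolding r_def w_def[symmetric] using w l by simp
  \<comment> \<open>This is x_j / z: by the equation, x_j times the conjugate of z equals |x_j|^2 -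
    l, which is real.\<close>
  define t where "t j = ((cmod (x j))\<^sup>2 - real l) / w" for j
  have t: "x j = of_real (t j) * z" if "j \<in> {1..m}" for j
  proof -
    have "x j * cnj z = of_real (t j * w)"
    proof -
      have "t j * w = (cmod (x j))\<^sup>2 - real l"
        using w by (simp add: t_def)
      moreover have "x j * cnj z = of_real ((cmod (x j))\<^sup>2 - real l)"
        using eq[OF that] by (simp add: algebra_simps complex_norm_square[symmetric])
      ultimately show ?thesis by (simp only:)
    qed
    then have "x j * (z * cnj z) = of_real (t j) * z * of_real w"
      by (simp add: mult_ac)
    then show ?thesis
      using w by (simp add: w_def complex_norm_square[symmetric])
  qed
  have norm: "(cmod (x j))\<^sup>2 = (t j)\<^sup>2 * w" if "j \<in> {1..m}" for j
    by (subst t[OF that]) (simp add: norm_mult power_mult_distrib w_def)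
  have "(2 * t j - 1)\<^sup>2 = r\<^sup>2" if "j \<in> {1..m}" for j
  proof -
    \<comment> \<open>Inserting |x_j|^2 = t_j^2 w into the definition of \<open>t\<close> gives the
      quadratic equation, whose discriminant is r^2.\<close>
    have "t j * w = (t j)\<^sup>2 * w - real l"
      using norm[OF that] w by (simp add: t_def)
    then show ?thesis using w unfolding r2 by (simp add: field_simps power2_eq_square)
  qed
  then have "\<exists>e::int. e \<in> {1, -1} \<and> 2 * t j - 1 = of_int e * r" if "j \<in> {1..m}" for j
    using that by (force simp: power2_eq_iff)
  then obtain e :: "nat \<Rightarrow> int" where e: "\<And>j. j \<in> {1..m} \<Longrightarrow> e j \<in> {1, -1}"
    and te: "\<And>j. j \<in> {1..m} \<Longrightarrow> 2 * t j - 1 = of_int (e j) * r"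
    by metis
  define E where "E = (\<Sum>j\<in>{1..m}. e j)"
  have "z = of_real (\<Sum>j\<in>{1..m}. t j) * z"
    by (subst z, subst sum.cong[OF refl t]) (simp_all add: sum_distrib_right)
  then have "(\<Sum>j\<in>{1..m}. t j) = 1"
    using z0 by (metis mult_cancel_right1 of_real_eq_1_iff)
  then have "of_int E * r = 2 - real m"
    by (simp add: E_def sum_distrib_right te[symmetric] sum_subtractf flip: sum_distrib_left)
  then have Er: "of_int (- E) * r = real m - 2" by simp
  have "- E > 0"
  proof -
    have "0 < of_int (- E) * r" using Er m by simp
    then show ?thesis
      using r1 by (simp only: zero_less_mult_iff of_int_0_less_iff) simp
  qed
  then have E1: "- E \<ge> 1" by simp
  have r_eq: "r = (real m - 2) / of_int (- E)"
    using Er \<open>- E > 0\<close> by (simp add: field_simps)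
  then show "r \<in> \<rat>"
    by (metis Rats_divide Rats_diff Rats_of_nat Rats_of_int Rats_number_of)
  \<comment> \<open>From r > 1 follows -E < -E r = m - 2. This bound excludes that all signs are -1,
    while \<open>E1\<close> excludes that all are 1.\<close>
  have "of_int (- E) < real m"
  proof -
    have "of_int (- E) * 1 < of_int (- E) * r"
      using r1 \<open>- E > 0\<close> by (intro mult_strict_left_mono) simp_all
    then show ?thesis using Er by linarith
  qed
  then have Em: "- E < int m" by linarith
  have *: "(cmod (x j))\<^sup>2 = (1 + of_int (e j) * r)\<^sup>2 / 4 * (cmod z)\<^sup>2" if "j \<in> {1..m}" for j
  proof -
    have "t j = (1 + of_int (e j) * r) / 2" using te[OF that] by simp
    then show ?thesis unfolding norm[OF that] w_def by (simp only: power_divide) simp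
  qed
  have "\<exists>j\<in>{1..m}. e j = 1"
  proof (rule ccontr)
    assume "\<not> ?thesis"
    then have "E = (\<Sum>j\<in>{1..m}. - 1)"
      unfolding E_def using e by (intro sum.cong) auto
    with Em show False by simp
  qed
  then show "\<exists>j\<in>{1..m}. (cmod (x j))\<^sup>2 = (1 + r)\<^sup>2 / 4 * (cmod z)\<^sup>2"
    using * by force
  have "\<exists>j\<in>{1..m}. e j = -1"
  proof (rule ccontr)
    assume "\<not> ?thesis"
    then have "E = (\<Sum>j\<in>{1..m}. 1)"
      unfolding E_def using e by (intro sum.cong) auto
    with E1 show False by simp
  qed
  then show "\<exists>j\<in>{1..m}. (cmod (x j))\<^sup>2 = (1 - r)\<^sup>2 / 4 * (cmod z)\<^sup>2"
    using * by force
qed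

section \<open>Elements of \<open>U_chi\<close> as squared absolute values\<close>

lemma char_ext_cyclo_int:
  assumes "comm_group G" "\<chi> \<in> characters G" "finite (carrier G)"
  shows "char_ext G \<chi> x \<in> cyclo_int (Coset.order G)"
  unfolding char_ext_def
  by (intro cyclo_int_sum cyclo_int_mult cyclo_int_of_int cyclo_int_root char_pow_order[OF assms(1,3,2)])

text \<open>The three members of \<open>T_chi\<close> are |z|^2 for z = chi(D) and |chi(D_j)|^2 for
  a D_j of either sign; the extra member l comes from D_1 under a character that vanishes on
  D.\<close>

lemma U_chi_norm:
  assumes sedf: "is_sedf G v m k l D" and m: "m > 2"
    and \<chi>: "\<chi> \<in> chars_nonzero G (\<Union>i\<in>{1..m}. D i)"
    and u: "u \<in> U_chi G l (\<Union>i\<in>{1..m}. D i) \<chi>"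
  shows "u \<noteq> 0 \<and> (\<exists>\<psi>\<in>characters G. \<exists>A. u = (cmod (char_ext G \<psi> (gr_set A)))\<^sup>2)"
proof -
  let ?D = "\<Union>i\<in>{1..m}. D i"
  have l: "l \<ge> 1" using sedf by (simp add: is_sedf_def)
  show ?thesis
  proof (cases "u \<in> T_chi G l ?D \<chi>")
    case True
    have \<chi>': "\<chi> \<in> characters G" "\<chi> \<noteq> principal_char G" and z0: "char_ext G \<chi> (gr_set ?D) \<noteq> 0"
      using \<chi> by (auto simp: chars_nonzero_def)
    define z where "z = char_ext G \<chi> (gr_set ?D)"
    define r where "r = chi_ratio G l ?D \<chi>"
    define a where "a = real_of_int (a_chi G l ?D \<chi>)"
    define b where "b = real_of_int (b_chi G l ?D \<chi>)"
    have z: "z = (\<Sum>i\<in>{1..m}. char_ext G \<chi> (gr_set (D i)))"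
      unfolding z_def by (rule sedf_char_values(1)[OF sedf \<chi>', of 1]) (use m in simp)
    have r_def': "r = sqrt (1 + 4 * real l / (cmod z)\<^sup>2)"
      by (simp add: r_def z_def chi_ratio_def)
    note vals = balanced_values[OF m l z0[folded z_def] z sedf_char_values(2)[OF sedf \<chi>', folded z_def],
      folded r_def']
    have "lowest_terms r (b_chi G l ?D \<chi>) (a_chi G l ?D \<chi>)"
      using lowest_terms_chi vals(1,2) unfolding r_def by blast
    then have ab: "b > a" "a > 0" and r: "r = b / a"
      by (auto simp: lowest_terms_def a_def b_def)
    have ab2: "b\<^sup>2 - a\<^sup>2 = (b + a) * (b - a)"
      by (simp add: power2_eq_square algebra_simps)
    have w0: "(cmod z)\<^sup>2 > 0" using z0 by (simp add: z_def)
    \<comment> \<open>Solving this for |z|^2 with r = b / a yields the first member of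
      \<open>T_chi\<close>; the other two follow by the factors (1 + r)^2 / 4 and (1 - r)^2 /
      4.\<close>
    have "r\<^sup>2 = 1 + 4 * real l / (cmod z)\<^sup>2"
      unfolding r_def' by (rule real_sqrt_pow2) simp
    then have "(r\<^sup>2 - 1) * (cmod z)\<^sup>2 = 4 * real l"
      using w0 by (simp add: field_simps)
    then have "(b\<^sup>2 - a\<^sup>2) * (cmod z)\<^sup>2 = 4 * a\<^sup>2 * real l"
      using ab by (simp add: r power_divide field_simps)
    then have w: "(cmod z)\<^sup>2 = 4 * a\<^sup>2 * real l / ((b + a) * (b - a))"
      using ab unfolding ab2 by (simp add: eq_divide_eq mult.commute)
    have plus: "(1 + r)\<^sup>2 / 4 * (cmod z)\<^sup>2 = (b + a) * real l / (b - a)"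
    proof -
      have "(1 + r)\<^sup>2 = (b + a) * (b + a) / a\<^sup>2"
        using ab by (simp add: r field_simps power2_eq_square)
      then show ?thesis unfolding w using ab by simp
    qed
    have minus: "(1 - r)\<^sup>2 / 4 * (cmod z)\<^sup>2 = (b - a) * real l / (b + a)"
    proof -
      have "(1 - r)\<^sup>2 = (b - a) * (b - a) / a\<^sup>2"
        using ab by (simp add: r field_simps power2_eq_square)
      then show ?thesis unfolding w using ab by simp
    qed
    have "T_chi G l ?D \<chi>
        = {(cmod z)\<^sup>2, (1 + r)\<^sup>2 / 4 * (cmod z)\<^sup>2, (1 - r)\<^sup>2 / 4 * (cmod z)\<^sup>2}"
      unfolding plus minus unfolding w T_chi_def Let_def a_def[symmetric] b_def[symmetric] ab2 ..
    with True consider "u = (cmod z)\<^sup>2"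
      | "u = (1 + r)\<^sup>2 / 4 * (cmod z)\<^sup>2" | "u = (1 - r)\<^sup>2 / 4 * (cmod z)\<^sup>2"
      by blast
    then show ?thesis
    proof cases
      case 1
      moreover from this have "u \<noteq> 0" using w0 by simp
      ultimately show ?thesis using \<chi>'(1) unfolding z_def by metis
    next
      case 2
      moreover from this have "u \<noteq> 0" using w0 vals(1) by auto
      ultimately show ?thesis using \<chi>'(1) vals(3) by metis
    next
      case 3
      moreover from this have "u \<noteq> 0" using w0 vals(1) by auto
      ultimately show ?thesis using \<chi>'(1) vals(4) by metis
    qed
  next
    case False
    \<comment> \<open>Lying outside \<open>T_chi\<close> forces the branch where the cardinality is
      not 0, so a character vanishing on D exists.\<close>
    then have ul: "u = real l" and "chars_zero G ?D \<noteq> {}"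
      using u by (auto simp: U_chi_def split: if_splits)
    then obtain \<psi> where \<psi>: "\<psi> \<in> characters G" "\<psi> \<noteq> principal_char G"
      and zero: "char_ext G \<psi> (gr_set ?D) = 0"
      by (auto simp: chars_zero_def)
    let ?x = "char_ext G \<psi> (gr_set (D 1))"
    have "?x * cnj ?x = of_nat l"
      using sedf_char_values(2)[OF sedf \<psi>, of 1] m zero by simp
    then have "complex_of_real ((cmod ?x)\<^sup>2) = complex_of_real (real l)"
      by (simp only: complex_norm_square of_real_of_nat_eq)
    then have "real l = (cmod ?x)\<^sup>2" by (simp only: of_real_eq_iff)
    then show ?thesis using \<psi>(1) l unfolding ul by auto
  qed
qed

section \<open>Exact divisibility, primitive roots and the conclusion\<close>

lemma int_dvd_of_int: "int_dvd d (of_int u) \<longleftrightarrow> int d dvd u"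
  unfolding int_dvd_def of_int_eq_iff dvd_def ..

lemma exactly_divides_multiplicity:
  assumes "prime q" "u \<noteq> 0"
  shows "exactly_divides q (multiplicity (int q) u) (of_int u)"
proof -
  have "\<not> is_unit (int q)" using assms(1) by (auto dest: prime_gt_1_nat)
  then have "int q ^ n dvd u \<longleftrightarrow> n \<le> multiplicity (int q) u" for n
    using assms(2) by (intro power_dvd_iff_le_multiplicity) auto
  then show ?thesis
    by (simp only: exactly_divides_def int_dvd_of_int of_nat_power) simp
qed

text \<open>The powers of a primitive root run through all totatives of n, among them n - 1, which
  represents -1.\<close>

lemma residue_primroot_dvd_power_plus_1:
  assumes "n > 1" "residue_primroot n q"
  shows "\<exists>j. n dvd q ^ j + 1"
proof -
  have "n - 1 \<in> totatives n"
    using assms(1) coprime_diff_one_left_nat[of n] by (simp add: totatives_def)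
  then obtain j where "q ^ j mod n = n - 1"
    using residue_primroot_is_generator[OF assms] unfolding bij_betw_def by force
  then have "(q ^ j + 1) mod n = 0"
    using assms(1) by (metis le_add_diff_inverse2 less_imp_le mod_add_left_eq mod_self)
  then show ?thesis by auto
qed

theorem theorem5p15:
  fixes G :: "('a, 'b) monoid_scheme"
    and D :: "nat \<Rightarrow> 'a set"
    and p s v m k l :: nat
  assumes "prime p"
    and "v = p ^ s"
    and "nontrivial_sedf G v m k l D"
    and "m > 2"
  shows "\<forall>\<chi>\<in>chars_nonzero G (\<Union>i\<in>{1..m}. D i). \<forall>u\<in>U_chi G l (\<Union>i\<in>{1..m}. D i) \<chi>.
           \<forall>q::nat. prime q \<and> int_dvd q u \<and> residue_primroot (p ^ s) q \<longrightarrow>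
             (\<exists>f. even f \<and> exactly_divides q f u)"
proof (intro ballI allI impI, elim conjE)
  fix \<chi> u q
  assume \<chi>: "\<chi> \<in> chars_nonzero G (\<Union>i\<in>{1..m}. D i)"
    and u: "u \<in> U_chi G l (\<Union>i\<in>{1..m}. D i) \<chi>"
    and q: "prime q" and dvd: "int_dvd q u" and primroot: "residue_primroot (p ^ s) q"
  have sedf: "is_sedf G v m k l D" and k: "k > 1"
    using assms(3) by (auto simp: nontrivial_sedf_def)
  then have G: "comm_group G" and fin: "finite (carrier G)" and order: "Coset.order G = p ^ s"
    and D1: "D 1 \<subseteq> carrier G" "card (D 1) = k"
    using assms(2,4) by (auto simp: is_sedf_def)
  \<comment> \<open>Nontriviality enters here: the group contains D_1, which has k > 1
    elements.\<close>
  have n: "p ^ s > 1"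
    using card_mono[OF fin D1(1)] D1(2) k order by (simp add: Coset.order_def)
  obtain j where j: "p ^ s dvd q ^ j + 1"
    using residue_primroot_dvd_power_plus_1[OF n primroot] ..
  have coprime: "coprime q (p ^ s)"
    using primroot by (simp add: residue_primroot_def coprime_commute)
  obtain \<psi> A where \<psi>: "\<psi> \<in> characters G" and uA: "u = (cmod (char_ext G \<psi> (gr_set A)))\<^sup>2" and u0: "u \<noteq> 0"
    using U_chi_norm[OF sedf assms(4) \<chi> u] by blast
  \<comment> \<open>Divisibility in the sense of \<open>int_dvd\<close> includes that u is an
    integer.\<close>
  obtain w :: int where w: "u = of_int w"
    using dvd unfolding int_dvd_def by blast
  let ?x = "char_ext G \<psi> (gr_set A)"
  have "?x * cnj ?x = of_int w"
    using uA w by (metis complex_norm_square of_real_of_int_eq)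
  moreover have "?x \<in> cyclo_int (p ^ s)"
    using char_ext_cyclo_int[OF G \<psi> fin] by (simp add: order)
  moreover have "p ^ s > 0" "w \<noteq> 0" using n u0 w by linarith+
  ultimately have "even (multiplicity (int q) w)"
    using even_multiplicity_cyclo_int_norm[OF q _ coprime j] by blast
  then show "\<exists>f. even f \<and> exactly_divides q f u"
    using exactly_divides_multiplicity[OF q \<open>w \<noteq> 0\<close>] w by blast
qed

end
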